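(* Let $\Pi$ be the transcript of any deterministic protocol (message-passing model) for $k$-BIT$_{f,\tau}$ on input distribution $\mu$ with error probability $\delta$, for a sufficiently small constant $\delta$. Then $\Pr[\Pi\text{ is good}]\ge 0.96$.
   Context: $k$-BIT$_{f,\tau}$: there are $k$ sites $S_1,\dots,S_k$ and a coordinator, communicating in the message-passing model (only between coordinator and sites). $f:\mathcal X\times\mathcal Y\to\{0,1\}$ is arbitrary and $\tau$ is a distribution on $\mathcal X\times\mathcal Y$ such that for $(X,Y)\sim\tau$, $f(X,Y)=1$ with probability $\beta$, where $c_\beta/k\le\beta\le1/c_\beta$ for a sufficiently large constant $c_\beta$. Distribution $\mu$: sample $(X_1,Y)\sim\tau$, then independently $X_2,\dots,X_k\sim\tau\mid Y$; site $S_i$ gets $X_i$, the coordinator gets $Y$. Let $Z_i=f(X_i,Y)$ (i.i.d. Bernoulli$(\beta)$), $Z=(Z_1,\dots,Z_k)$. The goal is to output an approximation of $\sum_i Z_i$ up to additive error $\sqrt{\beta k}$; error probability is over $\mu$. For a transcript value $\pi$, $q_i^\pi=\Pr_\mu[Z_i=1\mid\Pi=\pi]$. Let $c_0$ be a sufficiently large constant. For an input with $Z=z$ producing transcript $\pi=\Pi(z)$: $\pi$ is bad$_1$ for $z$ if for at least a $0.1$ fraction of $\{i:z_i=1\}$, $q_i^\pi\le\beta/c_0$; $\pi$ is bad$_0$ for $z$ if for at least a $0.1$ fraction of $\{i:z_i=0\}$, $q_i^\pi\ge\beta/c_0$; $\pi$ is good for $z$ otherwise. "$\Pi$ is good" is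 the event that the transcript is good for the realized $Z$.
   Formalization: The transcript Π is taken to consist of all messages together with the coordinator's input Y, so q_i^π conditions on Y too (with messages alone the claim fails); τ is a discrete distribution, and independence of the Z_i is an explicit hypothesis. *)

theory Defs
  imports "HOL-Probability.Probability"
begin

type_synonym message = "bool list"

text \<open>One entry \<open>(i, m, r)\<close> of a history: the coordinator sends \<open>m\<close> to site \<open>i\<close>, which
  answers \<open>r\<close>. Either message may be empty, so one-way communication is included.\<close>

type_synonym history = "(nat \<times> message \<times> message) list"

text \<open>\<open>contact\<close> is the coordinator's next move (\<open>None\<close>: stop). The third argument of \<open>reply\<close> is
  the earlier traffic on the channel of that site: a site sees nothing else.\<close>

record ('x, 'y) protocol =
  contact :: "'y \<Rightarrow> history \<Rightarrow> (nat \<times> message) option"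
  reply :: "nat \<Rightarrow> 'x \<Rightarrow> (message \<times> message) list \<Rightarrow> message \<Rightarrow> message"
  answer :: "'y \<Rightarrow> history \<Rightarrow> real"

definition channel :: "nat \<Rightarrow> history \<Rightarrow> (message \<times> message) list" where
  "channel i h = map snd (filter (\<lambda>e. fst e = i) h)"

definition step :: "('x, 'y) protocol \<Rightarrow> (nat \<Rightarrow> 'x) \<Rightarrow> 'y \<Rightarrow> history \<Rightarrow> history" where
  "step P x y h = (case contact P y h of
      None \<Rightarrow> h
    | Some (i, m) \<Rightarrow> h @ [(i, m, reply P i (x i) (channel i h) m)])"

definition stopped :: "('x, 'y) protocol \<Rightarrow> (nat \<Rightarrow> 'x) \<Rightarrow> 'y \<Rightarrow> nat \<Rightarrow> bool" where
  "stopped P x y n \<longleftrightarrow> contact P y ((step P x y ^^ n) []) = None"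

definition deterministic_protocol :: "nat \<Rightarrow> ('x, 'y) protocol \<Rightarrow> bool" where
  "deterministic_protocol k P \<longleftrightarrow>
     (\<forall>y h i m. contact P y h = Some (i, m) \<longrightarrow> i \<in> {1..k}) \<and>
     (\<forall>x y. \<exists>n. stopped P x y n)"

definition messages :: "('x, 'y) protocol \<Rightarrow> (nat \<Rightarrow> 'x) \<Rightarrow> 'y \<Rightarrow> history" where
  "messages P x y = (step P x y ^^ (LEAST n. stopped P x y n)) []"

text \<open>The transcript is the coordinator's record of the run: its input \<open>Y\<close> and all messages.
  \<open>Y\<close> cannot be left out. Let \<open>Y\<close> be a uniform string of \<open>N\<close> bits, \<open>N\<close> much larger than \<open>k\<^sup>2\<close>,
  \<open>X = (J, Z xor Y\<^sub>J)\<close> with \<open>J\<close> a uniform position and \<open>Z\<close> an independent Bernoulli(\<open>\<beta>\<close>) bit, and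
  \<open>f (X, Y) = Z\<close>. If every site sends its input, the coordinator computes the sum exactly, but given
  the messages alone every \<open>Z\<^sub>i\<close> is still Bernoulli(\<open>\<beta>\<close>) as soon as the positions are distinct,
  so the messages alone would be bad for almost every input.\<close>

definition transcript ::
    "('x, 'y) protocol \<Rightarrow> (nat \<Rightarrow> 'x) \<times> 'y \<Rightarrow> 'y \<times> history" where
  "transcript P \<omega> = (snd \<omega>, messages P (fst \<omega>) (snd \<omega>))"

definition protocol_output :: "('x, 'y) protocol \<Rightarrow> (nat \<Rightarrow> 'x) \<times> 'y \<Rightarrow> real" where
  "protocol_output P \<omega> = answer P (snd \<omega>) (messages P (fst \<omega>) (snd \<omega>))"

definition cond_X :: "('x \<times> 'y) pmf \<Rightarrow> 'y \<Rightarrow> 'x pmf" where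
  "cond_X \<tau> y = map_pmf fst (cond_pmf \<tau> {p. snd p = y})"

definition mu :: "nat \<Rightarrow> ('x \<times> 'y) pmf \<Rightarrow> ((nat \<Rightarrow> 'x) \<times> 'y) pmf" where
  "mu k \<tau> =
     bind_pmf \<tau> (\<lambda>(x1, y).
       map_pmf (\<lambda>x. (x(1 := x1), y)) (Pi_pmf {2..k} undefined (\<lambda>_. cond_X \<tau> y)))"

definition Z :: "('x \<times> 'y \<Rightarrow> bool) \<Rightarrow> nat \<Rightarrow> (nat \<Rightarrow> 'x) \<times> 'y \<Rightarrow> bool" where
  "Z f i \<omega> = f (fst \<omega> i, snd \<omega>)"

definition error_prob ::
    "nat \<Rightarrow> ('x \<times> 'y \<Rightarrow> bool) \<Rightarrow> ('x \<times> 'y) pmf \<Rightarrow> real \<Rightarrow> ('x, 'y) protocol \<Rightarrow> real" where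
  "error_prob k f \<tau> \<beta> P =
     \<P>(\<omega> in measure_pmf (mu k \<tau>).
        \<bar>protocol_output P \<omega> - (\<Sum>i = 1..k. of_bool (Z f i \<omega>))\<bar> > sqrt (\<beta> * real k))"

definition q ::
    "nat \<Rightarrow> ('x \<times> 'y \<Rightarrow> bool) \<Rightarrow> ('x \<times> 'y) pmf \<Rightarrow> ('x, 'y) protocol \<Rightarrow> 'y \<times> history \<Rightarrow> nat \<Rightarrow> real"
  where
  "q k f \<tau> P \<pi> i = \<P>(\<omega> in measure_pmf (mu k \<tau>). Z f i \<omega> \<bar> transcript P \<omega> = \<pi>)"

text \<open>In \<open>bad1\<close>, \<open>bad0\<close> and \<open>good\<close>, \<open>qs\<close> stands for \<open>q\<^sup>\<pi>\<close> and \<open>z\<close> for the realized value of \<open>Z\<close>.\<close>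

definition bad1 :: "nat \<Rightarrow> real \<Rightarrow> real \<Rightarrow> (nat \<Rightarrow> real) \<Rightarrow> (nat \<Rightarrow> bool) \<Rightarrow> bool" where
  "bad1 k \<beta> c0 qs z \<longleftrightarrow>
     real (card {i \<in> {1..k}. z i \<and> qs i \<le> \<beta> / c0}) \<ge> 0.1 * real (card {i \<in> {1..k}. z i})"

definition bad0 :: "nat \<Rightarrow> real \<Rightarrow> real \<Rightarrow> (nat \<Rightarrow> real) \<Rightarrow> (nat \<Rightarrow> bool) \<Rightarrow> bool" where
  "bad0 k \<beta> c0 qs z \<longleftrightarrow>
     real (card {i \<in> {1..k}. \<not> z i \<and> qs i \<ge> \<beta> / c0}) \<ge> 0.1 * real (card {i \<in> {1..k}. \<not> z i})"

definition good :: "nat \<Rightarrow> real \<Rightarrow> real \<Rightarrow> (nat \<Rightarrow> real) \<Rightarrow> (nat \<Rightarrow> bool) \<Rightarrow> bool" where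
  "good k \<beta> c0 qs z \<longleftrightarrow> \<not> bad1 k \<beta> c0 qs z \<and> \<not> bad0 k \<beta> c0 qs z"

end

theory Submission
  imports Defs
begin

text \<open>Given the transcript \<open>\<pi>\<close>, the rectangle property of the message-passing model makes the \<open>Z\<^sub>i\<close>
  independent Bernoulli(\<open>q\<^sub>i\<close>) bits. A bit with \<open>q\<^sub>i \<le> \<beta> / c\<^sub>0\<close> equals 1 with probability at most
  \<open>\<beta> / c\<^sub>0\<close>, while about \<open>\<beta> k\<close> bits are 1, so Markov's inequality bounds the probability of \<open>bad1\<close>.
  If \<open>\<pi>\<close> is \<open>bad0\<close>, then (as \<open>\<Sum> q\<^sub>i = O(\<beta> k)\<close> with high probability) a constant fraction of the sites
  has \<open>\<beta> / c\<^sub>0 \<le> q\<^sub>i < 1/2\<close>. Then \<open>\<Sum> Z\<^sub>i\<close> still misses every interval of radius \<open>sqrt (\<beta> k)\<close> with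
  probability at least a constant depending on \<open>c\<^sub>0\<close>: tilting these \<open>q\<^sub>i\<close> so that the mean moves by
  a large multiple of \<open>sqrt (\<beta> k)\<close> changes the product measure only by a bounded \<open>\<chi>\<^sup>2\<close>-divergence.
  Since the output is a function of \<open>\<pi>\<close>, a small error probability makes such \<open>\<pi>\<close> rare.\<close>

subsection \<open>Sums of independent Bernoulli variables\<close>

text \<open>The probability that independent Bernoulli(\<open>p i\<close>) bits, with i in
  \<open>I\<close>, have exactly \<open>X\<close> as their set of ones. Weights on
  \<open>Pow I\<close> turn the concentration arguments into finite sums.\<close>

definition bern_weight :: "'a set \<Rightarrow> ('a \<Rightarrow> real) \<Rightarrow> 'a set \<Rightarrow> real" where
  "bern_weight I p X = (\<Prod>i\<in>X. p i) * (\<Prod>i\<in>I - X. 1 - p i)"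

lemma bern_weight_nonneg:
  assumes "\<And>i. i \<in> I \<Longrightarrow> 0 \<le> p i \<and> p i \<le> 1" "X \<subseteq> I"
  shows "0 \<le> bern_weight I p X"
  unfolding bern_weight_def using assms
  by (intro mult_nonneg_nonneg prod_nonneg) auto

lemma bern_weight_if:
  assumes "finite I" "X \<subseteq> I"
  shows "bern_weight I p X = (\<Prod>i\<in>I. if i \<in> X then p i else 1 - p i)"
proof -
  have "I \<inter> {i. i \<in> X} = X" "I \<inter> - {i. i \<in> X} = I - X" using assms(2) by auto
  then show ?thesis unfolding bern_weight_def using assms(1) by (simp add: prod.If_cases)
qed

lemma sum_bern_weight:
  assumes "finite I"
  shows "(\<Sum>X\<in>Pow I. bern_weight I p X) = 1"
  using prod_add[OF assms, of p "\<lambda>i. 1 - p i"] by (simp add: bern_weight_def)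

text \<open>Subsets are split by whether they contain \<open>j\<close>, so bit \<open>j\<close> is
  averaged first. This drives the induction for the variance.\<close>

lemma sum_bern_weight_insert:
  assumes "finite I" "j \<notin> I"
  shows "(\<Sum>X\<in>Pow (insert j I). bern_weight (insert j I) p X * F X) =
         (\<Sum>X\<in>Pow I. bern_weight I p X * ((1 - p j) * F X + p j * F (insert j X)))"
proof -
  have inj: "inj_on (insert j) (Pow I)"
    using assms(2) by (intro inj_onI) (metis Pow_iff insert_ident subset_iff)
  have out: "bern_weight (insert j I) p X = bern_weight I p X * (1 - p j)"
    and inn: "bern_weight (insert j I) p (insert j X) = bern_weight I p X * p j"
    if "X \<in> Pow I" for X
  proof -
    have j: "j \<notin> X" "finite X" "finite (I - X)" "j \<notin> I - X"
      using that assms by (auto intro: finite_subset)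
    have "insert j I - X = insert j (I - X)" "insert j I - insert j X = I - X"
      using j assms by auto
    with j show "bern_weight (insert j I) p X = bern_weight I p X * (1 - p j)"
      "bern_weight (insert j I) p (insert j X) = bern_weight I p X * p j"
      by (simp_all add: bern_weight_def)
  qed
  have "(\<Sum>X\<in>Pow (insert j I). bern_weight (insert j I) p X * F X) =
    (\<Sum>X\<in>Pow I. bern_weight (insert j I) p X * F X) +
    (\<Sum>X\<in>insert j ` Pow I. bern_weight (insert j I) p X * F X)"
    unfolding Pow_insert using assms by (intro sum.union_disjoint) auto
  also have "\<dots> = (\<Sum>X\<in>Pow I. bern_weight I p X * ((1 - p j) * F X + p j * F (insert j X)))"
    by (simp add: sum.reindex[OF inj] out inn sum.distrib[symmetric] algebra_simps)
  finally show ?thesis .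
qed

lemma bern_weight_variance:
  assumes "finite I"
  shows "(\<Sum>X\<in>Pow I. bern_weight I p X * (real (card X) - (\<Sum>i\<in>I. p i))\<^sup>2)
       = (\<Sum>i\<in>I. p i * (1 - p i))"
  using assms
proof (induction I rule: finite_induct)
  case empty
  then show ?case by (simp add: bern_weight_def)
next
  case (insert j I)
  let ?s = "\<Sum>i\<in>I. p i"
  have card: "card (insert j X) = Suc (card X)" if "X \<in> Pow I" for X
    using that insert by (meson Pow_iff card_insert_disjoint finite_subset subsetD)
  \<comment> \<open>For each fixed \<open>X\<close> the cross term averages to zero over bit
    \<open>j\<close>, because that bit has mean \<open>p j\<close>.\<close>
  have "(1 - p j) * (real (card X) - (p j + ?s))\<^sup>2 +
        p j * (real (card (insert j X)) - (p j + ?s))\<^sup>2 =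
        (real (card X) - ?s)\<^sup>2 + p j * (1 - p j)" if "X \<in> Pow I" for X
    unfolding card[OF that] of_nat_Suc by (simp add: power2_eq_square algebra_simps)
  then have "(\<Sum>X\<in>Pow (insert j I). bern_weight (insert j I) p X * (real (card X) - (p j + ?s))\<^sup>2)
     = (\<Sum>X\<in>Pow I. bern_weight I p X * ((real (card X) - ?s)\<^sup>2 + p j * (1 - p j)))"
    unfolding sum_bern_weight_insert[OF insert.hyps] by (intro sum.cong) auto
  also have "\<dots> = (\<Sum>i\<in>I. p i * (1 - p i)) + p j * (1 - p j)"
    using insert.IH sum_bern_weight[OF insert.hyps(1), of p]
    by (simp add: distrib_left sum.distrib sum_distrib_right[symmetric])
  finally show ?case using insert.hyps by simp
qed

text \<open>The variance is at most the mean, so a bound on the mean alone controls the width of the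
  window.\<close>

lemma bern_weight_Chebyshev:
  assumes "finite I" "\<And>i. i \<in> I \<Longrightarrow> 0 \<le> p i \<and> p i \<le> 1" "t > 0"
  shows "(\<Sum>X\<in>{X\<in>Pow I. \<bar>real (card X) - (\<Sum>i\<in>I. p i)\<bar> \<ge> t}. bern_weight I p X)
      \<le> (\<Sum>i\<in>I. p i) / t\<^sup>2"
proof -
  let ?d = "\<lambda>X. real (card X) - (\<Sum>i\<in>I. p i)"
  have sq: "t\<^sup>2 \<le> (?d X)\<^sup>2" if "\<bar>?d X\<bar> \<ge> t" for X
    using power_mono[OF that, of 2] assms(3) by simp
  have "(\<Sum>X\<in>{X\<in>Pow I. \<bar>?d X\<bar> \<ge> t}. bern_weight I p X) * t\<^sup>2
      \<le> (\<Sum>X\<in>{X\<in>Pow I. \<bar>?d X\<bar> \<ge> t}. bern_weight I p X * (?d X)\<^sup>2)"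
    unfolding sum_distrib_right
    by (intro sum_mono mult_left_mono) (auto simp: sq intro!: bern_weight_nonneg dest: assms(2))
  also have "\<dots> \<le> (\<Sum>X\<in>Pow I. bern_weight I p X * (?d X)\<^sup>2)"
    using assms by (intro sum_mono2) (auto intro!: mult_nonneg_nonneg bern_weight_nonneg)
  also have "\<dots> \<le> (\<Sum>i\<in>I. p i)"
    unfolding bern_weight_variance[OF assms(1)]
    using assms(2) by (intro sum_mono) (auto simp: mult_left_le)
  finally show ?thesis using assms(3) by (simp add: field_simps)
qed

text \<open>Cauchy--Schwarz against the \<open>\<chi>\<^sup>2\<close>-divergence of two product measures, which factorises.\<close>

lemma bern_weight_change_of_measure:
  assumes "finite I" "\<And>i. i \<in> I \<Longrightarrow> 0 \<le> p i \<and> p i \<le> 1" "A \<subseteq> Pow I"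
    and abs_cont: "\<And>i. i \<in> I \<Longrightarrow> p' i = p i \<or> 0 < p i \<and> p i < 1"
  shows "(\<Sum>X\<in>A. bern_weight I p' X)\<^sup>2 \<le>
         (\<Prod>i\<in>I. (p' i)\<^sup>2 / p i + (1 - p' i)\<^sup>2 / (1 - p i)) * (\<Sum>X\<in>A. bern_weight I p X)"
proof -
  let ?w = "bern_weight I p" and ?w' = "bern_weight I p'"
  have nn: "0 \<le> ?w X" if "X \<in> Pow I" for X
    using bern_weight_nonneg assms(2) that by (metis PowD)
  have zero: "?w' X = 0" if X: "X \<in> Pow I" and w: "?w X = 0" for X
  proof -
    have fin: "finite X" "finite (I - X)" using X assms(1) by (auto intro: finite_subset)
    from w have "(\<exists>i\<in>X. p i = 0) \<or> (\<exists>i\<in>I - X. 1 - p i = 0)"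
      using fin unfolding bern_weight_def by auto
    then have "(\<exists>i\<in>X. p' i = 0) \<or> (\<exists>i\<in>I - X. 1 - p' i = 0)"
      using abs_cont X by (metis DiffD1 PowD diff_gt_0_iff_gt less_irrefl subsetD)
    then show ?thesis using fin unfolding bern_weight_def by auto
  qed
  \<comment> \<open>Division by zero gives zero, so cancelling \<open>sqrt (?w X)\<close> requires
    \<open>?w' X = 0\<close> wherever \<open>?w X = 0\<close>.\<close>
  have "(\<Sum>X\<in>A. ?w' X) = (\<Sum>X\<in>A. (?w' X / sqrt (?w X)) * sqrt (?w X))"
    using assms(3) zero by (intro sum.cong) auto
  then have "(\<Sum>X\<in>A. ?w' X)\<^sup>2 \<le> (\<Sum>X\<in>A. (?w' X / sqrt (?w X))\<^sup>2) * (\<Sum>X\<in>A. (sqrt (?w X))\<^sup>2)"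
    using Cauchy_Schwarz_ineq_sum by metis
  also have "(\<Sum>X\<in>A. (sqrt (?w X))\<^sup>2) = (\<Sum>X\<in>A. ?w X)"
    using assms(3) nn by (intro sum.cong) auto
  also have "(\<Sum>X\<in>A. (?w' X / sqrt (?w X))\<^sup>2) = (\<Sum>X\<in>A. (?w' X)\<^sup>2 / ?w X)"
    using assms(3) nn by (intro sum.cong) (auto simp: power_divide)
  also have "(\<Sum>X\<in>A. (?w' X)\<^sup>2 / ?w X) * (\<Sum>X\<in>A. ?w X) \<le>
             (\<Sum>X\<in>Pow I. (?w' X)\<^sup>2 / ?w X) * (\<Sum>X\<in>A. ?w X)"
    using assms(1,3) nn
    by (intro mult_right_mono sum_mono2 sum_nonneg) (auto intro!: divide_nonneg_nonneg)
  \<comment> \<open>Each quotient is again a product over \<open>I\<close>, so the sum over all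
    subsets is an expanded product.\<close>
  also have "(\<Sum>X\<in>Pow I. (?w' X)\<^sup>2 / ?w X) =
      (\<Prod>i\<in>I. (p' i)\<^sup>2 / p i + (1 - p' i)\<^sup>2 / (1 - p i))"
    unfolding prod_add[OF assms(1)] bern_weight_def
    by (simp add: prod_dividef prod_power_distrib power_mult_distrib)
  finally show ?thesis .
qed

text \<open>The two outcomes contribute \<open>2 * d\<close> and \<open>- 2 * d\<close>, which
  cancel; only the terms quadratic in \<open>d\<close> survive.\<close>

lemma chi_square_bernoulli:
  fixes x d :: real
  assumes "0 < x" "x < 1"
  shows "(x + d)\<^sup>2 / x + (1 - (x + d))\<^sup>2 / (1 - x) = 1 + d\<^sup>2 / (x * (1 - x))"
  using assms by (simp add: divide_simps) (simp add: power2_eq_square algebra_simps)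

text \<open>Raising the intermediate probabilities by \<open>8000 * L / k\<close>, where \<open>L = sqrt (\<beta> * k)\<close>, moves the mean
  by at least \<open>200 * L\<close>. This exceeds the two Chebyshev windows \<open>20 * L\<close> and \<open>130 * L\<close> plus the width
  \<open>2 * L\<close> of the interval around \<open>a\<close>, so that interval misses the bulk of the original or of the
  shifted distribution. The shift costs a factor \<open>exp (2 * 8000\<^sup>2 * c)\<close> in the \<open>\<chi>\<^sup>2\<close>-divergence.\<close>

lemma bern_weight_anticoncentration:
  fixes p :: "'a \<Rightarrow> real" and \<beta> c a :: real
  assumes fin: "finite I"
    and p: "\<And>i. i \<in> I \<Longrightarrow> 0 \<le> p i \<and> p i \<le> 1"
    and c: "c > 0" and \<beta>: "\<beta> \<le> 1 / 16000" and n: "1 \<le> \<beta> * real (card I)"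
    and total: "(\<Sum>i\<in>I. p i) \<le> 200 * (\<beta> * real (card I))"
    and G: "real (card {i\<in>I. \<beta> / c \<le> p i \<and> p i < 1/2}) \<ge> real (card I) / 40"
  shows "exp (- (2 * 8000\<^sup>2 * c)) / 4 \<le>
    (\<Sum>X\<in>{X\<in>Pow I. \<bar>a - real (card X)\<bar> > sqrt (\<beta> * real (card I))}. bern_weight I p X)"
proof -
  define k where "k = real (card I)"
  define L where "L = sqrt (\<beta> * k)"
  define d where "d = 8000 * L / k"
  define G' where "G' = {i\<in>I. \<beta> / c \<le> p i \<and> p i < 1/2}"
  define p' where "p' i = (if i \<in> G' then p i + d else p i)" for i
  define m where "m = (\<Sum>i\<in>I. p i)"
  have k: "k > 0" using n unfolding k_def
    by (metis mult_zero_right not_one_le_zero of_nat_0_le_iff order_less_le)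
  have \<beta>0: "\<beta> > 0" using n k unfolding k_def
    by (smt (verit, best) mult_nonneg_nonneg mult_nonpos_nonneg)
  have L2: "L\<^sup>2 = \<beta> * k" using k \<beta>0 by (simp add: L_def)
  have L1: "L \<ge> 1" using n by (simp add: L_def k_def)
  have LL: "L \<le> L\<^sup>2" using L1 by (simp add: power2_eq_square)
  have d0: "d > 0" using L1 k by (simp add: d_def)
  \<comment> \<open>The bound \<open>1 / 16000\<close> on \<beta> enters here. Since
    \<open>p i < 1/2\<close> on \<open>G'\<close>, the raised values stay below 1.\<close>
  have d_half: "d \<le> 1/2"
  proof -
    have "L \<le> \<beta> * k" using LL L2 by simp
    also have "\<dots> \<le> 1 / 16000 * k" using \<beta> k by (intro mult_right_mono) auto
    finally show ?thesis using k by (simp add: d_def divide_simps)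
  qed
  have d2: "d\<^sup>2 = 8000\<^sup>2 * \<beta> / k"
    using k L2 by (simp add: d_def power_divide power_mult_distrib) (simp add: power2_eq_square)
  have G'sub: "G' \<subseteq> I" and finG': "finite G'" using fin by (auto simp: G'_def)
  have cardG': "k / 40 \<le> real (card G')" "real (card G') \<le> k"
    using G card_mono[OF fin G'sub] by (auto simp: G'_def k_def)
  have p': "0 \<le> p' i \<and> p' i \<le> 1" if "i \<in> I" for i
    using p[OF that] d0 d_half by (auto simp: p'_def G'_def)
  have pG: "0 < p i" "p i < 1" if "i \<in> G'" for i
    using that \<beta>0 c by (auto simp: G'_def intro: less_le_trans[OF divide_pos_pos])
  have sum_p': "(\<Sum>i\<in>I. p' i) = m + real (card G') * d"
  proof -
    have "(\<Sum>i\<in>I. p' i) = (\<Sum>i\<in>I. p i + (if i \<in> G' then d else 0))"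
      by (intro sum.cong) (auto simp: p'_def)
    also have "\<dots> = m + real (card (I \<inter> G')) * d"
      using fin by (simp add: sum.distrib m_def sum.inter_restrict[symmetric])
    also have "I \<inter> G' = G'" using G'sub by auto
    finally show ?thesis .
  qed
  have shift: "200 * L \<le> real (card G') * d" "real (card G') * d \<le> 8000 * L"
  proof -
    have "k / 40 * d \<le> real (card G') * d" "real (card G') * d \<le> k * d"
      using cardG' d0 by (auto intro: mult_right_mono)
    then show "200 * L \<le> real (card G') * d" "real (card G') * d \<le> 8000 * L"
      using k by (auto simp: d_def)
  qed
  have m_le: "m \<le> 200 * L\<^sup>2" using total L2 by (simp add: m_def k_def)
  let ?err = "{X\<in>Pow I. \<bar>a - real (card X)\<bar> > L}"
  \<comment> \<open>Chebyshev with \<open>t\<^sup>2\<close> at least twice the mean. For the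
    original mean, at most \<open>200 * L\<^sup>2\<close>, this allows
    \<open>t = 20 * L\<close>.\<close>
  have half: "1/2 \<le> (\<Sum>X\<in>{X\<in>Pow I. \<not> \<bar>real (card X) - (\<Sum>i\<in>I. r i)\<bar> \<ge> t}. bern_weight I r X)"
    if r: "\<And>i. i \<in> I \<Longrightarrow> 0 \<le> r i \<and> r i \<le> 1" and t: "t > 0" "2 * (\<Sum>i\<in>I. r i) \<le> t\<^sup>2" for r t
  proof -
    let ?A = "{X\<in>Pow I. \<bar>real (card X) - (\<Sum>i\<in>I. r i)\<bar> \<ge> t}"
    let ?B = "{X\<in>Pow I. \<not> \<bar>real (card X) - (\<Sum>i\<in>I. r i)\<bar> \<ge> t}"
    have "?A \<union> ?B = Pow I" by auto
    then have "1 = sum (bern_weight I r) (?A \<union> ?B)"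
      using sum_bern_weight[OF fin, of r] by simp
    also have "\<dots> = sum (bern_weight I r) ?A + sum (bern_weight I r) ?B"
      using fin by (intro sum.union_disjoint) auto
    finally have "1 = sum (bern_weight I r) ?A + sum (bern_weight I r) ?B" .
    moreover have "sum (bern_weight I r) ?A \<le> (\<Sum>i\<in>I. r i) / t\<^sup>2"
      by (rule bern_weight_Chebyshev[OF fin r t(1)])
    moreover have "(\<Sum>i\<in>I. r i) / t\<^sup>2 \<le> 1/2" using t by (simp add: divide_simps)
    ultimately show ?thesis by linarith
  qed
  have nn: "0 \<le> bern_weight I p X" if "X \<in> Pow I" for X
    using bern_weight_nonneg p that by (metis PowD)
  \<comment> \<open>Either the interval around \<open>a\<close> lies to the right of the original
    window, or it ends by \<open>m + 22 * L\<close>, while the shifted window starts no earlier than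
    \<open>m + (200 - 130) * L\<close>.\<close>
  have "exp (- (2 * 8000\<^sup>2 * c)) / 4 \<le> sum (bern_weight I p) ?err"
  proof (cases "m + 20 * L < a - L")
    case True
    have "1/2 \<le> (\<Sum>X\<in>{X\<in>Pow I. \<not> \<bar>real (card X) - (\<Sum>i\<in>I. p i)\<bar> \<ge> 20 * L}. bern_weight I p X)"
      using m_le L1 by (intro half p) (auto simp: m_def power_mult_distrib)
    also have "\<dots> \<le> sum (bern_weight I p) ?err"
      using True fin nn by (intro sum_mono2) (auto simp: m_def)
    finally have "1/2 \<le> sum (bern_weight I p) ?err" .
    moreover have "exp (- (2 * 8000\<^sup>2 * c)) \<le> 1" using c by simp
    ultimately show ?thesis by linarith
  next
    case False
    let ?B = "{X\<in>Pow I. \<not> \<bar>real (card X) - (\<Sum>i\<in>I. p' i)\<bar> \<ge> 130 * L}"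
    \<comment> \<open>As \<open>L \<le> L\<^sup>2\<close>, the shifted mean is at most
      \<open>8200 * L\<^sup>2\<close>, and \<open>2 * 8200 \<le> 130\<^sup>2\<close>.\<close>
    have "1/2 \<le> (\<Sum>X\<in>?B. bern_weight I p' X)"
      using m_le L1 LL shift by (intro half p') (auto simp: sum_p' power_mult_distrib)
    \<comment> \<open>The change of measure bounds the square of the shifted mass, whence the
      denominator 4 in the claim.\<close>
    then have "(1/2)\<^sup>2 \<le> (\<Sum>X\<in>?B. bern_weight I p' X)\<^sup>2" by (intro power_mono) auto
    also have "\<dots> \<le> (\<Prod>i\<in>I. (p' i)\<^sup>2 / p i + (1 - p' i)\<^sup>2 / (1 - p i)) * (\<Sum>X\<in>?B. bern_weight I p X)"
      using pG by (intro bern_weight_change_of_measure fin p) (auto simp: p'_def)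
    also have "\<dots> \<le> exp (2 * 8000\<^sup>2 * c) * (\<Sum>X\<in>?B. bern_weight I p X)"
    proof (rule mult_right_mono)
      \<comment> \<open>On \<open>G'\<close> both \<open>p i \<ge> \<beta> / c\<close> and
        \<open>1 - p i \<ge> 1/2\<close> hold, so a raised bit costs at most
        \<open>2 * c * d\<^sup>2 / \<beta>\<close>; this is the exponent divided by
        \<open>k\<close>.\<close>
      have factor: "(p' i)\<^sup>2 / p i + (1 - p' i)\<^sup>2 / (1 - p i) \<le> exp (2 * 8000\<^sup>2 * c / k)"
        if "i \<in> I" for i
      proof (cases "i \<in> G'")
        case True
        have lower: "\<beta> / (2 * c) \<le> p i * (1 - p i)"
        proof -
          have "\<beta> / c * (1/2) \<le> p i * (1 - p i)"
            using True \<beta>0 c pG[OF True] by (intro mult_mono) (auto simp: G'_def)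
          then show ?thesis by simp
        qed
        have "d\<^sup>2 / (p i * (1 - p i)) \<le> d\<^sup>2 / (\<beta> / (2 * c))"
          using lower \<beta>0 c by (intro divide_left_mono mult_pos_pos) (auto intro: less_le_trans pG True)
        also have "\<dots> = 2 * 8000\<^sup>2 * c / k"
          using \<beta>0 c k unfolding d2 by (simp add: field_simps)
        finally have "1 + d\<^sup>2 / (p i * (1 - p i)) \<le> exp (2 * 8000\<^sup>2 * c / k)"
          using exp_ge_add_one_self[of "2 * 8000\<^sup>2 * c / k"] by linarith
        then show ?thesis
          using True chi_square_bernoulli[OF pG[OF True], of d] by (simp add: p'_def)
      next
        case False
        \<comment> \<open>With \<open>0 / 0 = 0\<close>, the identity
          \<open>x\<^sup>2 / x = x\<close> also covers \<open>p i\<close> equal to 0 or 1.\<close>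
        have "(p' i)\<^sup>2 / p i + (1 - p' i)\<^sup>2 / (1 - p i) = 1"
          using False by (simp add: p'_def power2_eq_square)
        then show ?thesis using c k by simp
      qed
      have "(\<Prod>i\<in>I. (p' i)\<^sup>2 / p i + (1 - p' i)\<^sup>2 / (1 - p i)) \<le> (\<Prod>i\<in>I. exp (2 * 8000\<^sup>2 * c / k))"
        using factor p by (intro prod_mono) (auto intro!: add_nonneg_nonneg divide_nonneg_nonneg)
      also have "\<dots> = exp (2 * 8000\<^sup>2 * c)"
        using k by (simp add: exp_of_nat_mult[symmetric] k_def)
      finally show "(\<Prod>i\<in>I. (p' i)\<^sup>2 / p i + (1 - p' i)\<^sup>2 / (1 - p i)) \<le> exp (2 * 8000\<^sup>2 * c)" .
    qed (auto intro!: sum_nonneg nn)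
    also have "\<dots> \<le> exp (2 * 8000\<^sup>2 * c) * sum (bern_weight I p) ?err"
      using False fin nn shift L1
      by (intro mult_left_mono sum_mono2) (auto simp: sum_p' abs_if split: if_splits)
    finally show ?thesis by (simp add: exp_minus field_simps)
  qed
  then show ?thesis by (simp add: L_def k_def)
qed

subsection \<open>Conditioning discrete distributions\<close>

text \<open>Law of total probability: draw the value of \<open>T\<close>, then draw from its fibre.
  It serves both for transcripts and for splitting \<tau> along \<open>snd\<close>.\<close>

lemma bind_cond_pmf_fibres:
  "bind_pmf (map_pmf T M) (\<lambda>t. cond_pmf M {\<omega>. T \<omega> = t}) = M"
proof (rule bind_cond_pmf_cancel)
  fix t \<omega> assume t: "T \<omega> = t"
  have "T -` {t'. T \<omega> = t'} = {\<omega>'. T \<omega>' = t}" using t by auto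
  then show "measure M {\<omega>'. T \<omega>' = t} = measure (map_pmf T M) {t'. T \<omega> = t'}" by simp
qed auto

lemma measure_bind_pmf_eq_integral:
  "measure (measure_pmf (bind_pmf M N)) A = (\<integral>x. measure (N x) A \<partial>measure_pmf M)"
  unfolding measure_pmf_bind
  by (subst measure_pmf.measure_bind[where N="count_space UNIV"])
     (auto simp: measure_pmf_in_subprob_algebra measurable_measure_pmf)

text \<open>Tower property with the value of \<open>T\<close> frozen inside the conditional
  probability. With \<open>T\<close> the transcript, the answer and the \<open>q\<close> values are
  constants there.\<close>

lemma measure_tower_pmf:
  "measure (measure_pmf M) {\<omega>. E (T \<omega>) \<omega>} =
    (\<integral>\<omega>. measure (cond_pmf M {\<omega>'. T \<omega>' = T \<omega>}) {\<omega>'. E (T \<omega>) \<omega>'} \<partial>measure_pmf M)"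
proof -
  let ?N = "\<lambda>t. cond_pmf M {\<omega>'. T \<omega>' = t}"
  have "measure M {\<omega>. E (T \<omega>) \<omega>} = measure (bind_pmf (map_pmf T M) ?N) {\<omega>. E (T \<omega>) \<omega>}"
    by (simp only: bind_cond_pmf_fibres)
  also have "\<dots> = (\<integral>\<omega>. measure (?N (T \<omega>)) {\<omega>'. E (T \<omega>') \<omega>'} \<partial>measure_pmf M)"
    by (simp add: measure_bind_pmf_eq_integral)
  also have "\<dots> = (\<integral>\<omega>. measure (?N (T \<omega>)) {\<omega>'. E (T \<omega>) \<omega>'} \<partial>measure_pmf M)"
  proof (intro integral_cong_AE AE_pmfI)
    fix \<omega> assume "\<omega> \<in> set_pmf M"
    then have "set_pmf M \<inter> {\<omega>'. T \<omega>' = T \<omega>} \<noteq> {}" by auto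
    then show "measure (?N (T \<omega>)) {\<omega>'. E (T \<omega>') \<omega>'} = measure (?N (T \<omega>)) {\<omega>'. E (T \<omega>) \<omega>'}"
      by (intro measure_pmf.finite_measure_eq_AE AE_pmfI) (auto simp: set_cond_pmf)
  qed auto
  finally show ?thesis .
qed

lemma measure_cond_pmf:
  assumes "\<omega> \<in> set_pmf M" "\<omega> \<in> A"
  shows "measure (cond_pmf M A) E = measure M (E \<inter> A) / measure M A"
proof -
  have A: "set_pmf M \<inter> A \<noteq> {}" using assms by auto
  have "measure M (E \<inter> A) = infsetsum (pmf M) (E \<inter> A)" by (simp add: measure_pmf_conv_infsetsum)
  moreover have "measure (cond_pmf M A) E = measure (cond_pmf M A) (E \<inter> A)"
    using A by (intro measure_pmf.finite_measure_eq_AE AE_pmfI) (auto simp: set_cond_pmf)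
  moreover have "\<dots> = infsetsum (\<lambda>x. pmf M x / measure M A) (E \<inter> A)"
    unfolding measure_pmf_conv_infsetsum[of "cond_pmf M A"]
    by (intro infsetsum_cong) (auto simp: pmf_cond[OF A])
  moreover have "\<dots> = infsetsum (pmf M) (E \<inter> A) / measure M A"
    by (intro infsetsum_cdiv) auto
  ultimately show ?thesis by simp
qed

text \<open>Passes from the space of inputs to finite weights: an event that depends only on the set
  of ones is a disjoint union of patterns.\<close>

lemma measure_event_of_pattern:
  fixes N :: "'w pmf"
  assumes "finite I"
    and "\<And>X. X \<subseteq> I \<Longrightarrow> measure N {\<omega>. {i\<in>I. B i \<omega>} = X} = w X"
  shows "measure N {\<omega>. F {i\<in>I. B i \<omega>}} = sum w {X\<in>Pow I. F X}"
proof -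
  let ?\<zeta> = "\<lambda>\<omega>. {i\<in>I. B i \<omega>}"
  have "measure N {\<omega>. F (?\<zeta> \<omega>)} = measure (map_pmf ?\<zeta> N) {X\<in>Pow I. F X}"
    by (auto intro!: arg_cong[where f="measure (measure_pmf N)"])
  also have "\<dots> = (\<Sum>X\<in>{X\<in>Pow I. F X}. pmf (map_pmf ?\<zeta> N) X)"
    using assms(1) by (intro measure_measure_pmf_finite) auto
  also have "\<dots> = sum w {X\<in>Pow I. F X}"
    using assms(2) by (intro sum.cong) (auto simp: pmf_map vimage_def)
  finally show ?thesis .
qed

lemma integrable_pmf_unit_interval:
  fixes g :: "'w \<Rightarrow> real"
  assumes "\<And>\<omega>. 0 \<le> g \<omega> \<and> g \<omega> \<le> 1"
  shows "integrable (measure_pmf M) g"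
  using assms by (intro measure_pmf.integrable_const_bound[where B=1]) auto

text \<open>Linearity of expectation followed by Markov's inequality; the summands may be
  dependent.\<close>

lemma Markov_sum_pmf:
  fixes g :: "'i \<Rightarrow> 'w \<Rightarrow> real"
  assumes "\<And>i \<omega>. 0 \<le> g i \<omega> \<and> g i \<omega> \<le> 1" "t > 0"
    and "\<And>i. i \<in> I \<Longrightarrow> (\<integral>\<omega>. g i \<omega> \<partial>measure_pmf M) \<le> b"
  shows "measure (measure_pmf M) {\<omega>. t \<le> (\<Sum>i\<in>I. g i \<omega>)} \<le> real (card I) * b / t"
proof -
  have int: "integrable (measure_pmf M) (g i)" for i
    using assms(1) by (intro integrable_pmf_unit_interval) auto
  have "measure (measure_pmf M) {\<omega>. t \<le> (\<Sum>i\<in>I. g i \<omega>)} \<le>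
      (\<integral>\<omega>. (\<Sum>i\<in>I. g i \<omega>) \<partial>measure_pmf M) / t"
    using integral_Markov_inequality_measure[of "measure_pmf M" "\<lambda>\<omega>. \<Sum>i\<in>I. g i \<omega>" UNIV t]
      int assms(1,2) by (simp add: sum_nonneg)
  also have "(\<integral>\<omega>. (\<Sum>i\<in>I. g i \<omega>) \<partial>measure_pmf M) = (\<Sum>i\<in>I. \<integral>\<omega>. g i \<omega> \<partial>measure_pmf M)"
    using int by simp
  also have "\<dots> \<le> real (card I) * b" using assms(3) by (rule sum_bounded_above)
  finally show ?thesis using assms(2) by (simp add: divide_right_mono)
qed

lemma integral_of_bool_pmf:
  "(\<integral>\<omega>. of_bool (B \<omega>) \<partial>measure_pmf M) = measure (measure_pmf M) {\<omega>. B \<omega>}"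
proof -
  have "(\<lambda>\<omega>. of_bool (B \<omega>) :: real) = indicator {\<omega>. B \<omega>}" by (auto simp: indicator_def)
  then show ?thesis by simp
qed

lemma card_filter_eq_sum_of_bool:
  assumes "finite I"
  shows "real (card {i\<in>I. B i}) = (\<Sum>i\<in>I. of_bool (B i))"
  using assms by (simp add: of_bool_def sum.If_cases Int_def)

lemma pattern_of_indep:
  assumes indep: "prob_space.indep_vars (measure_pmf M) (\<lambda>_. count_space UNIV) B I"
    and fin: "finite I" and X: "X \<subseteq> I"
    and p: "\<And>i. i \<in> I \<Longrightarrow> measure (measure_pmf M) {\<omega>. B i \<omega>} = p i"
  shows "measure (measure_pmf M) {\<omega>. {i\<in>I. B i \<omega>} = X} = bern_weight I p X"
\<comment> \<open>\<open>indep_setsD\<close> asks for a nonempty index set, so the empty case is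
  separate.\<close>
proof (cases "I = {}")
  case True
  then show ?thesis using X by (simp add: bern_weight_def)
next
  case False
  have "measure (measure_pmf M) {\<omega>. {i\<in>I. B i \<omega>} = X} =
      measure (measure_pmf M) (\<Inter>i\<in>I. B i -` {i \<in> X} \<inter> space (measure_pmf M))"
    using X False by (intro arg_cong[where f="measure (measure_pmf M)"]) auto
  also have "\<dots> = (\<Prod>i\<in>I. measure (measure_pmf M) (B i -` {i \<in> X} \<inter> space (measure_pmf M)))"
    using indep False fin
    unfolding prob_space.indep_vars_def2[OF measure_pmf.prob_space_axioms]
    by (intro prob_space.indep_setsD[OF measure_pmf.prob_space_axioms, where I=I]) auto
  also have "\<dots> = (\<Prod>i\<in>I. if i \<in> X then p i else 1 - p i)"
  proof (rule prod.cong[OF refl])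
    fix i assume i: "i \<in> I"
    have "B i -` {False} = UNIV - {\<omega>. B i \<omega>}" by auto
    moreover have "measure (measure_pmf M) (UNIV - {\<omega>. B i \<omega>}) = 1 - p i"
      using measure_pmf.prob_compl[of "{\<omega>. B i \<omega>}" M] p[OF i] by simp
    moreover have "B i -` {True} = {\<omega>. B i \<omega>}" by auto
    ultimately show "measure (measure_pmf M) (B i -` {i \<in> X} \<inter> space (measure_pmf M)) =
        (if i \<in> X then p i else 1 - p i)"
      using p[OF i] by (cases "i \<in> X") simp_all
  qed
  finally show ?thesis using bern_weight_if[OF fin X] by simp
qed

subsection \<open>Transcripts of deterministic protocols\<close>

text \<open>The conditions on \<open>h\<close> that concern the coordinator alone; they do not
  involve the inputs of the sites.\<close>

definition run_shape :: "('x, 'y) protocol \<Rightarrow> 'y \<Rightarrow> history \<Rightarrow> bool" where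
  "run_shape P y h \<longleftrightarrow> contact P y h = None \<and> (\<forall>n<length h. contact P y (take n h) \<noteq> None)"

text \<open>The side of the rectangle that belongs to site \<open>i\<close>: for fixed
  \<open>y\<close> and \<open>h\<close> it restricts only the input \<open>xi\<close>.\<close>

definition site_consistent :: "('x, 'y) protocol \<Rightarrow> 'y \<Rightarrow> history \<Rightarrow> nat \<Rightarrow> 'x \<Rightarrow> bool" where
  "site_consistent P y h i xi \<longleftrightarrow> (\<forall>n<length h. \<forall>m. contact P y (take n h) = Some (i, m) \<longrightarrow>
     h ! n = (i, m, reply P i xi (channel i (take n h)) m))"

text \<open>Before stopping, each step appends exactly one entry, so the step count is the length
  and earlier histories are prefixes.\<close>

lemma step_pow_prefix:
  assumes "\<And>n. n < N \<Longrightarrow> \<not> stopped P x y n" "n \<le> N"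
  shows "length ((step P x y ^^ n) []) = n \<and> take n ((step P x y ^^ N) []) = (step P x y ^^ n) []"
  using assms
proof (induction N arbitrary: n)
  case 0
  then show ?case by simp
next
  case (Suc N)
  let ?h = "(step P x y ^^ N) []"
  have len: "length ?h = N" using Suc.IH[of N] Suc.prems(1) by simp
  have "contact P y ?h \<noteq> None" using Suc.prems(1)[of N] by (simp add: stopped_def)
  then obtain i m where "contact P y ?h = Some (i, m)" by auto
  then have next_h: "(step P x y ^^ Suc N) [] = ?h @ [(i, m, reply P i (x i) (channel i ?h) m)]"
    by (simp add: step_def)
  show ?case
  proof (cases "n = Suc N")
    case True
    then show ?thesis using next_h len by simp
  next
    case False
    then have "n \<le> N" using Suc.prems(2) by simp
    then show ?thesis using Suc.IH[of n] Suc.prems(1) next_h len by simp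
  qed
qed

text \<open>Rectangle property: a reply depends on the site's own input and on earlier channel
  traffic, which can be read off \<open>h\<close>. For fixed \<open>y\<close> the inputs leading to
  \<open>h\<close> thus form a product set.\<close>

lemma messages_eq_iff:
  assumes P: "deterministic_protocol k P"
  shows "messages P x y = h \<longleftrightarrow> run_shape P y h \<and> (\<forall>i\<in>{1..k}. site_consistent P y h i (x i))"
proof
  assume h: "messages P x y = h"
  define N where "N = (LEAST n. stopped P x y n)"
  have N: "stopped P x y N"
    using P unfolding deterministic_protocol_def N_def by (blast intro: LeastI_ex)
  have before: "\<not> stopped P x y n" if "n < N" for n
    using that not_less_Least N_def by metis
  have hN: "h = (step P x y ^^ N) []" using h by (simp add: messages_def N_def)
  have len: "length h = N"
    using step_pow_prefix[of N P x y N] before hN by simp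
  have pre: "take n h = (step P x y ^^ n) []" if "n \<le> N" for n
    using step_pow_prefix[of N P x y] before that hN by auto
  have "site_consistent P y h i (x i)" for i
    unfolding site_consistent_def
  proof (intro allI impI)
    fix n m assume n: "n < length h" and c: "contact P y (take n h) = Some (i, m)"
    have "take (Suc n) h = step P x y (take n h)" using pre[of n] pre[of "Suc n"] n len by simp
    also have "\<dots> = take n h @ [(i, m, reply P i (x i) (channel i (take n h)) m)]"
      using c by (simp add: step_def)
    finally show "h ! n = (i, m, reply P i (x i) (channel i (take n h)) m)"
      using n by (simp add: take_Suc_conv_app_nth)
  qed
  moreover have "run_shape P y h"
    unfolding run_shape_def using N before pre hN len by (auto simp: stopped_def)
  ultimately show "run_shape P y h \<and> (\<forall>i\<in>{1..k}. site_consistent P y h i (x i))" by simp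
next
  assume h: "run_shape P y h \<and> (\<forall>i\<in>{1..k}. site_consistent P y h i (x i))"
  have pre: "(step P x y ^^ n) [] = take n h" if "n \<le> length h" for n
    using that
  proof (induction n)
    case 0
    then show ?case by simp
  next
    case (Suc n)
    then have n: "n < length h" by simp
    then obtain i m where c: "contact P y (take n h) = Some (i, m)"
      using h unfolding run_shape_def by fastforce
    \<comment> \<open>Only sites in \<open>{1..k}\<close> are ever contacted, so their consistency
      determines every entry of \<open>h\<close>.\<close>
    then have "i \<in> {1..k}" using P unfolding deterministic_protocol_def by blast
    then have "h ! n = (i, m, reply P i (x i) (channel i (take n h)) m)"
      using h n c unfolding site_consistent_def by blast
    then show ?case using Suc c n by (simp add: step_def take_Suc_conv_app_nth)
  qed
  have "(LEAST n. stopped P x y n) = length h"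
  proof (rule Least_equality)
    show "stopped P x y (length h)" using pre[of "length h"] h by (simp add: stopped_def run_shape_def)
    show "length h \<le> n" if "stopped P x y n" for n
    proof (rule ccontr)
      assume "\<not> length h \<le> n"
      then show False using that pre[of n] h unfolding stopped_def run_shape_def by auto
    qed
  qed
  then show "messages P x y = h" using pre[of "length h"] by (simp add: messages_def)
qed

section \<open>Structure of the input distribution\<close>

lemma pmf_snd_disintegration:
  "bind_pmf (map_pmf snd \<tau>) (\<lambda>y. map_pmf (\<lambda>x. (x, y)) (cond_X \<tau> y)) = \<tau>"
proof -
  have "bind_pmf (map_pmf snd \<tau>) (\<lambda>y. map_pmf (\<lambda>x. (x, y)) (cond_X \<tau> y))
      = bind_pmf (map_pmf snd \<tau>) (\<lambda>y. cond_pmf \<tau> {p. snd p = y})"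
  proof (intro bind_pmf_cong refl)
    fix y assume "y \<in> set_pmf (map_pmf snd \<tau>)"
    then have "set_pmf \<tau> \<inter> {p. snd p = y} \<noteq> {}" by auto
    then have "map_pmf (\<lambda>p. (fst p, y)) (cond_pmf \<tau> {p. snd p = y}) =
        map_pmf (\<lambda>p. p) (cond_pmf \<tau> {p. snd p = y})"
      by (intro map_pmf_cong refl) (auto simp: set_cond_pmf)
    then show "map_pmf (\<lambda>x. (x, y)) (cond_X \<tau> y) = cond_pmf \<tau> {p. snd p = y}"
      by (simp add: cond_X_def pmf.map_comp o_def)
  qed
  also have "\<dots> = \<tau>"
    by (rule bind_cond_pmf_fibres)
  finally show ?thesis .
qed

text \<open>Splitting \<tau> into \<open>y\<close> and a draw from \<open>cond_X\<close> removes the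
  special role of site 1: given \<open>y\<close>, all \<open>k\<close> inputs are i.i.d.\<close>

lemma mu_eq:
  assumes "k \<ge> 1"
  shows "mu k \<tau> = bind_pmf (map_pmf snd \<tau>)
    (\<lambda>y. map_pmf (\<lambda>x. (x, y)) (Pi_pmf {1..k} undefined (\<lambda>_. cond_X \<tau> y)))"
proof -
  have ins: "{1..k} = insert 1 {2..k}" using assms by auto
  have "mu k \<tau> = bind_pmf (bind_pmf (map_pmf snd \<tau>) (\<lambda>y. map_pmf (\<lambda>x. (x, y)) (cond_X \<tau> y)))
     (\<lambda>(x1, y). map_pmf (\<lambda>x. (x(1 := x1), y)) (Pi_pmf {2..k} undefined (\<lambda>_. cond_X \<tau> y)))"
    unfolding mu_def pmf_snd_disintegration ..
  also have "\<dots> = bind_pmf (map_pmf snd \<tau>)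
    (\<lambda>y. map_pmf (\<lambda>x. (x, y)) (Pi_pmf {1..k} undefined (\<lambda>_. cond_X \<tau> y)))"
    unfolding ins
    by (subst Pi_pmf_insert')
       (simp_all only: map_pmf_def bind_assoc_pmf bind_return_pmf split_conv
         finite_atLeastAtMost atLeastAtMost_iff, simp)
  finally show ?thesis .
qed

lemma mu_marginal:
  assumes "i \<in> {1..k}"
  shows "map_pmf (\<lambda>\<omega>. (fst \<omega> i, snd \<omega>)) (mu k \<tau>) = \<tau>"
proof -
  have "map_pmf (\<lambda>\<omega>. (fst \<omega> i, snd \<omega>)) (mu k \<tau>) = bind_pmf (map_pmf snd \<tau>)
     (\<lambda>y. map_pmf (\<lambda>x. (x, y)) (map_pmf (\<lambda>x. x i) (Pi_pmf {1..k} undefined (\<lambda>_. cond_X \<tau> y))))"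
    using assms by (subst mu_eq) (auto simp: map_bind_pmf pmf.map_comp o_def)
  also have "\<dots> = \<tau>"
    using assms by (simp only: Pi_pmf_component pmf_snd_disintegration finite_atLeastAtMost if_True)
  finally show ?thesis .
qed

lemma prob_Z:
  assumes "i \<in> {1..k}"
  shows "measure (mu k \<tau>) {\<omega>. Z f i \<omega>} = measure \<tau> {p. f p}"
proof -
  have "measure \<tau> {p. f p} = measure (map_pmf (\<lambda>\<omega>. (fst \<omega> i, snd \<omega>)) (mu k \<tau>)) {p. f p}"
    by (simp only: mu_marginal[OF assms])
  then show ?thesis by (simp add: Z_def vimage_def)
qed

text \<open>Fixing \<open>y\<close> selects one component of the mixture, in which the coordinates
  are independent.\<close>

lemma measure_mu_rectangle:
  assumes "k \<ge> 1"
  shows "measure (mu k \<tau>) {\<omega>. snd \<omega> = y \<and> (\<forall>i\<in>{1..k}. Q i (fst \<omega> i))} =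
    pmf (map_pmf snd \<tau>) y * (\<Prod>i=1..k. measure (cond_X \<tau> y) {x. Q i x})"
proof -
  let ?S = "{\<omega>. snd \<omega> = y \<and> (\<forall>i\<in>{1..k}. Q i (fst \<omega> i))}"
  let ?c = "\<Prod>i=1..k. measure (cond_X \<tau> y) {x. Q i x}"
  have inner: "measure (map_pmf (\<lambda>x. (x, y')) (Pi_pmf {1..k} undefined (\<lambda>_. cond_X \<tau> y'))) ?S
     = ?c * indicator {y} y'" for y'
  proof (cases "y' = y")
    case True
    have "(\<lambda>x. (x, y)) -` ?S = Pi {1..k} (\<lambda>i. {x. Q i x})" by (auto simp: Pi_def)
    then show ?thesis using True by (simp add: measure_Pi_pmf_Pi)
  qed (simp add: vimage_def)
  have "measure (mu k \<tau>) ?S = (\<integral>y'. ?c * indicator {y} y' \<partial>measure_pmf (map_pmf snd \<tau>))"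
    unfolding mu_eq[OF assms] measure_bind_pmf_eq_integral inner ..
  then show ?thesis by (simp add: measure_pmf_single del: integral_map_pmf)
qed

section \<open>Conditional law of the bits given the transcript\<close>

lemma q_eq_cond_pmf:
  assumes "\<omega> \<in> set_pmf (mu k \<tau>)"
  shows "q k f \<tau> P (transcript P \<omega>) i =
    measure (cond_pmf (mu k \<tau>) {\<omega>'. transcript P \<omega>' = transcript P \<omega>}) {\<omega>'. Z f i \<omega>'}"
  unfolding q_def cond_prob_def
  by (subst measure_cond_pmf[OF assms]) (auto simp: Int_def)

text \<open>This includes a \<pi> of probability zero, where the quotient is 0 by
  convention.\<close>

lemma q_bounds: "0 \<le> q k f \<tau> P \<pi> i \<and> q k f \<tau> P \<pi> i \<le> 1"
proof -
  have "measure (mu k \<tau>) {\<omega>. Z f i \<omega> \<and> transcript P \<omega> = \<pi>} \<le> measure (mu k \<tau>) {\<omega>. transcript P \<omega> = \<pi>}"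
    by (intro measure_pmf.finite_measure_mono) auto
  then show ?thesis unfolding q_def cond_prob_def by (simp add: divide_le_eq_1 measure_nonneg)
      (metis measure_nonneg order_less_le)
qed

text \<open>The transcript contains \<open>y\<close>, so fixing it selects a rectangle inside one
  component of \<open>mu\<close>; conditioning independent coordinates on a rectangle keeps them
  independent.\<close>

lemma pattern_given_transcript:
  assumes k: "k \<ge> 1" and P: "deterministic_protocol k P" and \<omega>: "\<omega> \<in> set_pmf (mu k \<tau>)"
    and X: "X \<subseteq> {1..k}"
  shows "measure (cond_pmf (mu k \<tau>) {\<omega>'. transcript P \<omega>' = transcript P \<omega>})
      {\<omega>'. {i\<in>{1..k}. Z f i \<omega>'} = X} = bern_weight {1..k} (q k f \<tau> P (transcript P \<omega>)) X"
proof -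
  let ?M = "mu k \<tau>" and ?I = "{1..k}"
  let ?A = "{\<omega>'. transcript P \<omega>' = transcript P \<omega>}"
  define y where "y = snd \<omega>"
  define h where "h = messages P (fst \<omega>) y"
  define S where "S = site_consistent P y h"
  define c where "c = pmf (map_pmf snd \<tau>) y"
  \<comment> \<open>\<open>r i\<close> is the chance that site i replies as in \<open>h\<close>, and
    \<open>u i\<close> the chance that its bit is 1 as well; \<open>u i / r i\<close> will be its
    \<open>q\<close> value.\<close>
  define r where "r i = measure (cond_X \<tau> y) {x. S i x}" for i
  define u where "u i = measure (cond_X \<tau> y) {x. S i x \<and> f (x, y)}" for i
  have shape: "run_shape P y h" using messages_eq_iff[OF P, of "fst \<omega>" y h] h_def by simp
  have A: "?A = {\<omega>'. snd \<omega>' = y \<and> (\<forall>i\<in>?I. S i (fst \<omega>' i))}"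
    using messages_eq_iff[OF P, of _ y h] shape
    by (auto simp: transcript_def y_def[symmetric] h_def[symmetric] S_def)
  have mA: "measure ?M ?A = c * (\<Prod>i\<in>?I. r i)"
    unfolding A measure_mu_rectangle[OF k] c_def r_def ..
  \<comment> \<open>The witness \<omega> has positive mass, so no \<open>r i\<close>
    vanishes.\<close>
  have "measure ?M ?A > 0" using \<omega> by (intro measure_pmf_posI[of \<omega>]) auto
  then have "c \<noteq> 0" "(\<Prod>i\<in>?I. r i) \<noteq> 0" unfolding mA
    by (metis less_irrefl mult_zero_left, metis less_irrefl mult_zero_right)
  then have ne: "c \<noteq> 0" "\<And>i. i \<in> ?I \<Longrightarrow> r i \<noteq> 0" by auto
  have compl: "measure (cond_X \<tau> y) {x. S i x \<and> \<not> f (x, y)} = r i - u i" for i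
  proof -
    have "{x. S i x \<and> \<not> f (x, y)} = {x. S i x} - {x. S i x \<and> f (x, y)}" by auto
    then show ?thesis unfolding r_def u_def
      by (simp only:) (intro measure_pmf.finite_measure_Diff, auto)
  qed
  have q: "q k f \<tau> P (transcript P \<omega>) i = u i / r i" if i: "i \<in> ?I" for i
  proof -
    \<comment> \<open>Requiring bit i to be 1 constrains one coordinate, so a single factor
      changes.\<close>
    have "{\<omega>'. Z f i \<omega>'} \<inter> ?A =
        {\<omega>'. snd \<omega>' = y \<and> (\<forall>j\<in>?I. S j (fst \<omega>' j) \<and> (j = i \<longrightarrow> f (fst \<omega>' j, y)))}"
      unfolding A using i by (auto simp: Z_def)
    then have "measure ?M ({\<omega>'. Z f i \<omega>'} \<inter> ?A) =
        c * (\<Prod>j\<in>?I. measure (cond_X \<tau> y) {x. S j x \<and> (j = i \<longrightarrow> f (x, y))})"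
      using measure_mu_rectangle[OF k, of \<tau> y "\<lambda>j x. S j x \<and> (j = i \<longrightarrow> f (x, y))"]
      by (simp add: c_def)
    also have "(\<Prod>j\<in>?I. measure (cond_X \<tau> y) {x. S j x \<and> (j = i \<longrightarrow> f (x, y))})
        = (\<Prod>j\<in>?I. r j * (if j = i then u i / r i else 1))"
      using ne by (intro prod.cong) (auto simp: u_def r_def)
    also have "\<dots> = (\<Prod>j\<in>?I. r j) * (u i / r i)"
      using i by (simp add: prod.distrib prod.delta)
    finally have "measure ?M ({\<omega>'. Z f i \<omega>'} \<inter> ?A) = measure ?M ?A * (u i / r i)"
      by (simp add: mA)
    then show ?thesis
      using \<open>measure ?M ?A > 0\<close> \<omega> by (subst q_eq_cond_pmf[OF \<omega>], subst measure_cond_pmf[OF \<omega>]) auto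
  qed
  have "{\<omega>'. {i\<in>?I. Z f i \<omega>'} = X} \<inter> ?A =
      {\<omega>'. snd \<omega>' = y \<and> (\<forall>j\<in>?I. S j (fst \<omega>' j) \<and> (j \<in> X \<longleftrightarrow> f (fst \<omega>' j, y)))}"
    unfolding A using X by (auto simp: Z_def)
  then have "measure ?M ({\<omega>'. {i\<in>?I. Z f i \<omega>'} = X} \<inter> ?A) =
      c * (\<Prod>j\<in>?I. measure (cond_X \<tau> y) {x. S j x \<and> (j \<in> X \<longleftrightarrow> f (x, y))})"
    using measure_mu_rectangle[OF k, of \<tau> y "\<lambda>j x. S j x \<and> (j \<in> X \<longleftrightarrow> f (x, y))"]
    by (simp add: c_def)
  also have "(\<Prod>j\<in>?I. measure (cond_X \<tau> y) {x. S j x \<and> (j \<in> X \<longleftrightarrow> f (x, y))}) =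
      (\<Prod>j\<in>?I. r j * (if j \<in> X then u j / r j else 1 - u j / r j))"
  proof (rule prod.cong[OF refl])
    fix j assume "j \<in> ?I"
    then show "measure (cond_X \<tau> y) {x. S j x \<and> (j \<in> X \<longleftrightarrow> f (x, y))} =
      r j * (if j \<in> X then u j / r j else 1 - u j / r j)"
      using ne(2)[of j] compl[of j] by (auto simp: u_def[symmetric] right_diff_distrib)
  qed
  also have "\<dots> = (\<Prod>j\<in>?I. r j) * (\<Prod>j\<in>?I. if j \<in> X then u j / r j else 1 - u j / r j)"
    by (rule prod.distrib)
  also have "(\<Prod>j\<in>?I. if j \<in> X then u j / r j else 1 - u j / r j) =
      bern_weight ?I (q k f \<tau> P (transcript P \<omega>)) X"
    using X by (subst bern_weight_if) (auto intro!: prod.cong simp: q)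
  finally have "measure ?M ({\<omega>'. {i\<in>?I. Z f i \<omega>'} = X} \<inter> ?A) =
      measure ?M ?A * bern_weight ?I (q k f \<tau> P (transcript P \<omega>)) X"
    by (simp add: mA)
  then show ?thesis
    using \<open>measure ?M ?A > 0\<close> by (subst measure_cond_pmf[OF \<omega>]) auto
qed

subsection \<open>Probability of a good transcript\<close>

text \<open>Given a transcript, either \<open>q\<close> exceeds \<open>t\<close> and the event is
  empty, or its conditional probability is \<open>q\<close> itself.\<close>

lemma prob_Z_small_q:
  assumes "t \<ge> 0"
  shows "measure (mu k \<tau>) {\<omega>. Z f i \<omega> \<and> q k f \<tau> P (transcript P \<omega>) i \<le> t} \<le> t"
proof -
  let ?M = "mu k \<tau>" and ?T = "transcript P" and ?q = "\<lambda>\<omega>. q k f \<tau> P (transcript P \<omega>) i"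
  let ?E = "\<lambda>\<pi> \<omega>. Z f i \<omega> \<and> q k f \<tau> P \<pi> i \<le> t"
  have "measure ?M {\<omega>. ?E (?T \<omega>) \<omega>} =
      (\<integral>\<omega>. measure (cond_pmf ?M {\<omega>'. ?T \<omega>' = ?T \<omega>}) {\<omega>'. ?E (?T \<omega>) \<omega>'} \<partial>measure_pmf ?M)"
    by (rule measure_tower_pmf)
  also have "\<dots> \<le> (\<integral>\<omega>. t \<partial>measure_pmf ?M)"
  proof (intro integral_mono_AE AE_pmfI)
    fix \<omega> assume "\<omega> \<in> set_pmf ?M"
    then show "measure (cond_pmf ?M {\<omega>'. ?T \<omega>' = ?T \<omega>}) {\<omega>'. ?E (?T \<omega>) \<omega>'} \<le> t"
      using q_eq_cond_pmf[of \<omega> k \<tau> f P i] assms by (cases "?q \<omega> \<le> t") simp_all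
  qed (auto intro!: integrable_pmf_unit_interval)
  finally show ?thesis by simp
qed

lemma expectation_q:
  "(\<integral>\<omega>. q k f \<tau> P (transcript P \<omega>) i \<partial>measure_pmf (mu k \<tau>)) = measure (mu k \<tau>) {\<omega>. Z f i \<omega>}"
  unfolding measure_tower_pmf[of "mu k \<tau>" "\<lambda>_. Z f i" "transcript P"]
  by (intro integral_cong_AE AE_pmfI) (auto simp: q_eq_cond_pmf)

text \<open>Given a transcript the answer is one real number, so anticoncentration of the
  conditional sum forces an error of constant probability on each transcript of the stated
  kind.\<close>

lemma error_prob_ge:
  assumes k: "k \<ge> 1" and P: "deterministic_protocol k P"
    and c: "c > 0" and \<beta>: "\<beta> \<le> 1 / 16000" and n: "1 \<le> \<beta> * real k"
  shows "exp (- (2 * 8000\<^sup>2 * c)) / 4 *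
      measure (mu k \<tau>) {\<omega>. (\<Sum>i=1..k. q k f \<tau> P (transcript P \<omega>) i) \<le> 200 * (\<beta> * real k) \<and>
        real k / 40 \<le> real (card {i\<in>{1..k}. \<beta> / c \<le> q k f \<tau> P (transcript P \<omega>) i \<and>
           q k f \<tau> P (transcript P \<omega>) i < 1/2})}
    \<le> error_prob k f \<tau> \<beta> P"
proof -
  let ?M = "mu k \<tau>" and ?T = "transcript P" and ?L = "sqrt (\<beta> * real k)"
  let ?d = "exp (- (2 * 8000\<^sup>2 * c)) / 4"
  define B where "B \<pi> \<longleftrightarrow> (\<Sum>i=1..k. q k f \<tau> P \<pi> i) \<le> 200 * (\<beta> * real k) \<and>
        real k / 40 \<le> real (card {i\<in>{1..k}. \<beta> / c \<le> q k f \<tau> P \<pi> i \<and> q k f \<tau> P \<pi> i < 1/2})" for \<pi>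
  define F where "F \<pi> X \<longleftrightarrow> \<bar>answer P (fst \<pi>) (snd \<pi>) - real (card X)\<bar> > ?L" for \<pi> and X :: "nat set"
  have "?d * measure ?M {\<omega>. B (?T \<omega>)} = (\<integral>\<omega>. ?d * of_bool (B (?T \<omega>)) \<partial>measure_pmf ?M)"
    by (simp add: integral_of_bool_pmf)
  also have "\<dots> \<le> (\<integral>\<omega>. measure (cond_pmf ?M {\<omega>'. ?T \<omega>' = ?T \<omega>})
      {\<omega>'. F (?T \<omega>) {i\<in>{1..k}. Z f i \<omega>'}} \<partial>measure_pmf ?M)"
  proof (intro integral_mono_AE AE_pmfI)
    fix \<omega> assume \<omega>: "\<omega> \<in> set_pmf ?M"
    show "?d * of_bool (B (?T \<omega>)) \<le> measure (cond_pmf ?M {\<omega>'. ?T \<omega>' = ?T \<omega>})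
      {\<omega>'. F (?T \<omega>) {i\<in>{1..k}. Z f i \<omega>'}}"
    proof (cases "B (?T \<omega>)")
      case True
      have "?d \<le> sum (bern_weight {1..k} (q k f \<tau> P (?T \<omega>))) {X\<in>Pow {1..k}. F (?T \<omega>) X}"
        using bern_weight_anticoncentration[of "{1..k}" "q k f \<tau> P (?T \<omega>)" c \<beta>
            "answer P (fst (?T \<omega>)) (snd (?T \<omega>))", OF _ q_bounds] c \<beta> n True
        unfolding B_def F_def by simp
      also have "\<dots> = measure (cond_pmf ?M {\<omega>'. ?T \<omega>' = ?T \<omega>}) {\<omega>'. F (?T \<omega>) {i\<in>{1..k}. Z f i \<omega>'}}"
        by (rule measure_event_of_pattern[symmetric, OF finite_atLeastAtMost
              pattern_given_transcript[OF k P \<omega>]])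
      finally show ?thesis using True by simp
    qed simp
  next
    show "integrable (measure_pmf ?M) (\<lambda>\<omega>. ?d * of_bool (B (?T \<omega>)))"
      by (intro integrable_mult_right integrable_pmf_unit_interval) auto
  qed (auto intro!: integrable_pmf_unit_interval)
  also have "\<dots> = measure ?M {\<omega>. F (?T \<omega>) {i\<in>{1..k}. Z f i \<omega>}}"
    by (rule measure_tower_pmf[symmetric])
  also have "\<dots> = error_prob k f \<tau> \<beta> P"
    unfolding F_def card_filter_eq_sum_of_bool[OF finite_atLeastAtMost]
    by (simp add: error_prob_def protocol_output_def transcript_def)
  finally show ?thesis by (simp add: B_def)
qed

lemma prob_good_ge:
  assumes k: "k \<ge> 1" and f: "\<P>(p in measure_pmf \<tau>. f p) = \<beta>"
    and \<beta>: "\<beta> \<le> 1 / 16000" and n: "16000 \<le> \<beta> * real k" and c: "c \<ge> 2000"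
    and indep: "prob_space.indep_vars (measure_pmf (mu k \<tau>)) (\<lambda>_. count_space UNIV) (Z f) {1..k}"
    and P: "deterministic_protocol k P"
    and err: "error_prob k f \<tau> \<beta> P \<le> exp (- (2 * 8000\<^sup>2 * c)) / 400"
  shows "\<P>(\<omega> in measure_pmf (mu k \<tau>).
          good k \<beta> c (q k f \<tau> P (transcript P \<omega>)) (\<lambda>i. Z f i \<omega>)) \<ge> 0.96"
proof -
  let ?M = "mu k \<tau>" and ?I = "{1..k}" and ?n = "\<beta> * real k"
  define Q where "Q \<omega> = q k f \<tau> P (transcript P \<omega>)" for \<omega>
  define N where "N \<omega> = card {i\<in>?I. Z f i \<omega>}" for \<omega>
  \<comment> \<open>Outside \<open>E1\<close> and \<open>E2\<close> the transcript is not
    \<open>bad1\<close>; outside \<open>E3\<close>, \<open>E4\<close> and \<open>E5\<close> it is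
    not \<open>bad0\<close>. \<open>E2\<close> uses a tenth of \<open>?n / 2\<close>, the least
    number of ones outside \<open>E1\<close>.\<close>
  define E1 where "E1 = {\<omega>. \<bar>real (N \<omega>) - ?n\<bar> \<ge> ?n / 2}"
  define E2 where "E2 = {\<omega>. real (card {i\<in>?I. Z f i \<omega> \<and> Q \<omega> i \<le> \<beta> / c}) \<ge> ?n / 20}"
  define E3 where "E3 = {\<omega>. real (N \<omega>) \<ge> real k / 2}"
  define E4 where "E4 = {\<omega>. (\<Sum>i\<in>?I. Q \<omega> i) \<ge> 200 * ?n}"
  define E5 where "E5 = {\<omega>. (\<Sum>i\<in>?I. Q \<omega> i) \<le> 200 * ?n \<and>
     real k / 40 \<le> real (card {i\<in>?I. \<beta> / c \<le> Q \<omega> i \<and> Q \<omega> i < 1/2})}"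
  have \<beta>0: "\<beta> > 0" using n k by (smt (verit) mult_nonpos_nonneg of_nat_0_le_iff)
  have pZ: "measure ?M {\<omega>. Z f i \<omega>} = \<beta>" if "i \<in> ?I" for i
    using prob_Z[OF that, of \<tau> f] f by simp
  have Q01: "0 \<le> Q \<omega> i" "Q \<omega> i \<le> 1" for \<omega> i using q_bounds unfolding Q_def by blast+
  \<comment> \<open>The assumed independence of the bits under \<open>mu\<close>, without
    conditioning, permits Chebyshev with the constant parameter \<beta>.\<close>
  have E1: "measure ?M E1 \<le> 4 / 16000"
  proof -
    have "measure ?M E1 = sum (bern_weight ?I (\<lambda>_. \<beta>)) {X\<in>Pow ?I. \<bar>real (card X) - ?n\<bar> \<ge> ?n / 2}"
      unfolding E1_def N_def
      by (rule measure_event_of_pattern[OF finite_atLeastAtMost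
            pattern_of_indep[OF indep finite_atLeastAtMost _ pZ]])
    also have "\<dots> \<le> ?n / (?n / 2)\<^sup>2"
      using bern_weight_Chebyshev[of ?I "\<lambda>_. \<beta>" "?n / 2"] \<beta>0 \<beta> n by (simp add: mult.commute)
    also have "\<dots> = 4 / ?n" using n by (simp add: field_simps power2_eq_square)
    also have "\<dots> \<le> 4 / 16000" using n by (intro divide_left_mono) auto
    finally show ?thesis .
  qed
  have E2: "measure ?M E2 \<le> 1 / 100"
  proof -
    have "measure ?M E2 \<le> real (card ?I) * (\<beta> / c) / (?n / 20)"
      unfolding E2_def card_filter_eq_sum_of_bool[OF finite_atLeastAtMost]
      using n \<beta>0 c
      by (intro Markov_sum_pmf) (auto simp: integral_of_bool_pmf Q_def intro!: prob_Z_small_q)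
    also have "\<dots> = 20 / c" using n \<beta>0 k by (simp add: field_simps)
    also have "\<dots> \<le> 1 / 100" using c by (simp add: field_simps)
    finally show ?thesis .
  qed
  have E3: "measure ?M E3 \<le> 2 / 16000"
  proof -
    have "measure ?M E3 \<le> real (card ?I) * \<beta> / (real k / 2)"
      unfolding E3_def N_def card_filter_eq_sum_of_bool[OF finite_atLeastAtMost]
      using k pZ by (intro Markov_sum_pmf) (auto simp: integral_of_bool_pmf)
    then show ?thesis using \<beta> k by simp
  qed
  have E4: "measure ?M E4 \<le> 1 / 200"
  proof -
    have "measure ?M E4 \<le> real (card ?I) * \<beta> / (200 * ?n)"
      unfolding E4_def
      using Q01 n pZ by (intro Markov_sum_pmf) (auto simp: Q_def expectation_q)
    then show ?thesis using n \<beta>0 k by simp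
  qed
  \<comment> \<open>The allowed error is one hundredth of the anticoncentration constant.\<close>
  have E5: "measure ?M E5 \<le> 1 / 100"
  proof -
    have "exp (- (2 * 8000\<^sup>2 * c)) / 4 * measure ?M E5 \<le> error_prob k f \<tau> \<beta> P"
      unfolding E5_def Q_def by (rule error_prob_ge[OF k P _ \<beta>]) (use c n in auto)
    with err have "exp (- (2 * 8000\<^sup>2 * c)) / 4 * measure ?M E5 \<le> exp (- (2 * 8000\<^sup>2 * c)) / 4 * (1 / 100)"
      by linarith
    then show ?thesis by (rule mult_left_le_imp_le) simp
  qed
  let ?G = "{\<omega>. good k \<beta> c (Q \<omega>) (\<lambda>i. Z f i \<omega>)}"
  have "\<omega> \<in> E1 \<union> E2 \<union> E3 \<union> E4 \<union> E5" if "\<omega> \<notin> ?G" for \<omega>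
  proof (rule ccontr)
    assume no: "\<omega> \<notin> E1 \<union> E2 \<union> E3 \<union> E4 \<union> E5"
    have "\<not> bad1 k \<beta> c (Q \<omega>) (\<lambda>i. Z f i \<omega>)"
      using no by (auto simp: bad1_def E1_def E2_def N_def abs_if split: if_splits)
    moreover have "\<not> bad0 k \<beta> c (Q \<omega>) (\<lambda>i. Z f i \<omega>)"
    proof
      assume bad: "bad0 k \<beta> c (Q \<omega>) (\<lambda>i. Z f i \<omega>)"
      have total: "(\<Sum>i\<in>?I. Q \<omega> i) \<le> 200 * ?n" using no by (simp add: E4_def)
      have split_I: "{i\<in>?I. Z f i \<omega>} \<union> {i\<in>?I. \<not> Z f i \<omega>} = ?I" by auto
      have "N \<omega> + card {i\<in>?I. \<not> Z f i \<omega>} = card ({i\<in>?I. Z f i \<omega>} \<union> {i\<in>?I. \<not> Z f i \<omega>})"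
        unfolding N_def by (intro card_Un_disjoint[symmetric]) auto
      then have zeros: "real k / 2 \<le> real (card {i\<in>?I. \<not> Z f i \<omega>})"
        using no unfolding split_I by (simp add: E3_def)
      \<comment> \<open>Among these sites at most \<open>2 * (\<Sum>i\<in>?I. Q \<omega> i)\<close>
        have \<open>q \<ge> 1/2\<close>, which is at most \<open>400 * ?n \<le> k / 40\<close>. So
        at least \<open>k / 40\<close> lie in the intermediate range.\<close>
      have "real k / 20 \<le> real (card {i\<in>?I. \<not> Z f i \<omega> \<and> Q \<omega> i \<ge> \<beta> / c})"
        using bad zeros by (simp add: bad0_def)
      also have "\<dots> \<le> real (card ({i\<in>?I. \<beta> / c \<le> Q \<omega> i \<and> Q \<omega> i < 1/2} \<union> {i\<in>?I. 1/2 \<le> Q \<omega> i}))"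
        by (intro of_nat_mono card_mono) auto
      also have "\<dots> \<le> real (card {i\<in>?I. \<beta> / c \<le> Q \<omega> i \<and> Q \<omega> i < 1/2}) + real (card {i\<in>?I. 1/2 \<le> Q \<omega> i})"
        using card_Un_le[of "{i\<in>?I. \<beta> / c \<le> Q \<omega> i \<and> Q \<omega> i < 1/2}" "{i\<in>?I. 1/2 \<le> Q \<omega> i}"] by linarith
      also have "real (card {i\<in>?I. 1/2 \<le> Q \<omega> i}) \<le> (\<Sum>i\<in>?I. 2 * Q \<omega> i)"
        unfolding card_filter_eq_sum_of_bool[OF finite_atLeastAtMost]
        using Q01 by (intro sum_mono) (auto simp: of_bool_def)
      also have "\<dots> \<le> 400 * ?n" using total by (simp add: sum_distrib_left[symmetric])
      also have "\<dots> \<le> real k / 40"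
        using mult_right_mono[OF \<beta>, of "real k"] by simp
      finally have "\<omega> \<in> E5" using total by (simp add: E5_def)
      then show False using no by simp
    qed
    ultimately show False using that by (simp add: good_def)
  qed
  then have "UNIV - ?G \<subseteq> E1 \<union> E2 \<union> E3 \<union> E4 \<union> E5" by auto
  then have "measure ?M (UNIV - ?G) \<le> measure ?M (E1 \<union> E2 \<union> E3 \<union> E4 \<union> E5)"
    by (intro measure_pmf.finite_measure_mono) auto
  also have "\<dots> \<le> measure ?M E1 + measure ?M E2 + measure ?M E3 + measure ?M E4 + measure ?M E5"
    by (intro order_trans[OF measure_subadditive] add_mono order_refl) auto
  also have "\<dots> \<le> 0.04" using E1 E2 E3 E4 E5 by simp
  finally have "1 - measure ?M ?G \<le> 0.04"
    using measure_pmf.prob_compl[of ?G ?M] by simp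
  then show ?thesis by (simp add: Q_def)
qed

theorem theorem1:
  "\<exists>C\<beta>>0. \<exists>C0>0. \<forall>c\<beta>\<ge>C\<beta>. \<forall>c0\<ge>C0. \<exists>\<delta>0>0.
     \<forall>(k :: nat) (f :: 'x \<times> 'y \<Rightarrow> bool) (\<tau> :: ('x \<times> 'y) pmf) (\<beta> :: real)
       (P :: ('x, 'y) protocol) (\<delta> :: real).
       k \<ge> 1 \<longrightarrow>
       \<P>(p in measure_pmf \<tau>. f p) = \<beta> \<longrightarrow>
       c\<beta> / real k \<le> \<beta> \<longrightarrow> \<beta> \<le> 1 / c\<beta> \<longrightarrow>
       prob_space.indep_vars (measure_pmf (mu k \<tau>)) (\<lambda>_. count_space UNIV) (Z f) {1..k} \<longrightarrow>
       deterministic_protocol k P \<longrightarrow>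
       \<delta> \<le> \<delta>0 \<longrightarrow> error_prob k f \<tau> \<beta> P \<le> \<delta> \<longrightarrow>
       \<P>(\<omega> in measure_pmf (mu k \<tau>).
          good k \<beta> c0 (q k f \<tau> P (transcript P \<omega>)) (\<lambda>i. Z f i \<omega>)) \<ge> 0.96"
proof (rule exI[of _ 16000], rule conjI, simp, rule exI[of _ 2000], rule conjI, simp, intro allI impI)
  fix c\<beta> c0 :: real assume c: "16000 \<le> c\<beta>" "2000 \<le> c0"
  show "\<exists>\<delta>0>0. \<forall>(k :: nat) (f :: 'x \<times> 'y \<Rightarrow> bool) (\<tau> :: ('x \<times> 'y) pmf) (\<beta> :: real)
       (P :: ('x, 'y) protocol) (\<delta> :: real).
       k \<ge> 1 \<longrightarrow>
       \<P>(p in measure_pmf \<tau>. f p) = \<beta> \<longrightarrow>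
       c\<beta> / real k \<le> \<beta> \<longrightarrow> \<beta> \<le> 1 / c\<beta> \<longrightarrow>
       prob_space.indep_vars (measure_pmf (mu k \<tau>)) (\<lambda>_. count_space UNIV) (Z f) {1..k} \<longrightarrow>
       deterministic_protocol k P \<longrightarrow>
       \<delta> \<le> \<delta>0 \<longrightarrow> error_prob k f \<tau> \<beta> P \<le> \<delta> \<longrightarrow>
       \<P>(\<omega> in measure_pmf (mu k \<tau>).
          good k \<beta> c0 (q k f \<tau> P (transcript P \<omega>)) (\<lambda>i. Z f i \<omega>)) \<ge> 0.96"
  \<comment> \<open>The error threshold is fixed after \<open>c0\<close> because the
    anticoncentration constant decays exponentially in \<open>c0\<close>.\<close>
  proof (rule exI[of _ "exp (- (2 * 8000\<^sup>2 * c0)) / 400"], rule conjI, simp, intro allI impI, goal_cases)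
    case (1 k f \<tau> \<beta> P \<delta>)
    \<comment> \<open>The single constant 16000 supplies both the upper bound on \<beta> and the
      lower bound on \<open>\<beta> * k\<close>.\<close>
    have "1 / c\<beta> \<le> 1 / 16000" using c by (intro divide_left_mono) auto
    then have "\<beta> \<le> 1 / 16000" using 1(4) by simp
    moreover have "c\<beta> \<le> \<beta> * real k" using 1(1,3) by (simp add: field_simps)
    then have "16000 \<le> \<beta> * real k" using c by simp
    ultimately show ?case using 1 c by (intro prob_good_ge) auto
  qed
qed

end
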